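(* Let $\Omega$ be a compact topological space and let $\mathcal{F}\subset C(\Omega)$. Then $\mathcal{F}$ is totally bounded in the supremum norm if and only if both of the following hold: (i) $\mathcal{F}$ is pointwise bounded, i.e. for every $x\in\Omega$, $\sup_{f\in\mathcal{F}}|f(x)|<\infty$; (ii) $\mathcal{F}$ is equicontinuous, i.e. for every $x\in\Omega$ and every $\epsilon>0$ there is a neighborhood $V$ of $x$ such that $|f(y)-f(x)|<\epsilon$ for all $y\in V$ and all $f\in\mathcal{F}$.
   Context: $C(\Omega)$ is the space of continuous real-valued functions on $\Omega$ with the norm $\|f\|_\infty=\sup_{x\in\Omega}|f(x)|$. No Hausdorff assumption is made on $\Omega$. A subset of a metric space is totally bounded if for every $\epsilon>0$ it can be covered by finitely many sets of diameter at most $\epsilon$. *)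

theory Defs
  imports "HOL-Analysis.Analysis"
begin

text \<open>
  The diameter is taken in the extended nonnegative reals, so that it is the genuine supremum also
  for unbounded sets; the empty set has diameter 0.
\<close>

definition mdiameter :: "'a metric \<Rightarrow> 'a set \<Rightarrow> ennreal" where
  "mdiameter m A = (SUP x\<in>A. SUP y\<in>A. ennreal (mdist m x y))"

definition totally_bounded_in :: "'a metric \<Rightarrow> 'a set \<Rightarrow> bool" where
  "totally_bounded_in m S \<longleftrightarrow>
     S \<subseteq> mspace m \<and>
     (\<forall>\<epsilon>::real. \<epsilon> > 0 \<longrightarrow>
        (\<exists>\<C>. finite \<C> \<and> (\<forall>A\<in>\<C>. A \<subseteq> mspace m \<and> mdiameter m A \<le> ennreal \<epsilon>) \<and> S \<subseteq> \<Union>\<C>))"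

text \<open>Neighbourhoods are not required to be open.\<close>

definition neighbourhood_in :: "'a topology \<Rightarrow> 'a \<Rightarrow> 'a set \<Rightarrow> bool" where
  "neighbourhood_in X x V \<longleftrightarrow> V \<subseteq> topspace X \<and> (\<exists>U. openin X U \<and> x \<in> U \<and> U \<subseteq> V)"

definition pointwise_bounded :: "'a topology \<Rightarrow> ('a \<Rightarrow> real) set \<Rightarrow> bool" where
  "pointwise_bounded X F \<longleftrightarrow> (\<forall>x\<in>topspace X. bdd_above ((\<lambda>f. \<bar>f x\<bar>) ` F))"

definition equicontinuous :: "'a topology \<Rightarrow> ('a \<Rightarrow> real) set \<Rightarrow> bool" where
  "equicontinuous X F \<longleftrightarrow>
     (\<forall>x\<in>topspace X. \<forall>\<epsilon>::real. \<epsilon> > 0 \<longrightarrow>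
        (\<exists>V. neighbourhood_in X x V \<and> (\<forall>y\<in>V. \<forall>f\<in>F. \<bar>f y - f x\<bar> < \<epsilon>)))"

text \<open>
  The space of continuous real functions is rendered by the metric space
  \<^term>\<open>cfunspace X (euclidean_metric :: real metric)\<close>.  Its members carry the value
  \<^term>\<open>undefined\<close> outside \<^term>\<open>topspace X\<close>, so that functions agreeing on the space
  are equal.  The next two lemmas record that, for compact \<^term>\<open>X\<close>, it consists of all continuous
  real functions and its distance is the one given by the supremum norm.
\<close>

lemma mspace_cfunspace_compact:
  assumes "compact_space X"
  shows "mspace (cfunspace X (euclidean_metric :: real metric)) =
           {f \<in> extensional (topspace X). continuous_map X euclideanreal f}"
  using assms
  by (subst compactin_mspace_cfunspace)
     (auto simp: compact_space_def mtopology_of_euclidean)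

lemma mdist_cfunspace_compact:
  fixes f g :: "'a \<Rightarrow> real"
  assumes "compact_space X" "topspace X \<noteq> {}"
    and "f \<in> mspace (cfunspace X euclidean_metric)" "g \<in> mspace (cfunspace X euclidean_metric)"
  shows "mdist (cfunspace X euclidean_metric) f g = (SUP x\<in>topspace X. \<bar>f x - g x\<bar>)"
proof -
  have "f \<in> mspace (funspace (topspace X) euclidean_metric)"
    and "g \<in> mspace (funspace (topspace X) euclidean_metric)"
    using assms(3,4) cfunspace_subset_funspace by blast+
  then show ?thesis
    using assms(2)
    by (simp add: mdist_cfunspace_eq_mdist_funspace Met_TC.fdist_def dist_real_def)
qed

end

theory Submission
  imports Defs
begin

text \<open>
  If \<open>F\<close> is totally bounded, it is uniformly approximated by finitely many continuous functions,
  and boundedness and equicontinuity pass from those to \<open>F\<close>.  Conversely, compactness yields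
  finitely many points \<open>T\<close> such that every point of the space has an \<open>x \<in> T\<close> at which all members
  of \<open>F\<close> take nearly the same value as at that point.  Rounding the values on \<open>T\<close> to a grid gives
  each function a signature; pointwise boundedness leaves only finitely many signatures, and
  functions with the same signature are uniformly close.
\<close>

text \<open>\<open>ennreal\<close> sends negative reals to 0, so a singleton would violate this for
  negative \<open>e\<close>.\<close>

lemma mdiameter_le_iff:
  assumes "0 \<le> e"
  shows "mdiameter m A \<le> ennreal e \<longleftrightarrow> (\<forall>x\<in>A. \<forall>y\<in>A. mdist m x y \<le> e)"
  using assms by (simp add: mdiameter_def SUP_le_iff ennreal_le_iff)

text \<open>One point is picked from each nonempty set of the cover. The net lies in the space but
  perhaps not in \<open>S\<close>; for function spaces its points are thus still continuous
  functions.\<close>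

lemma totally_bounded_in_imp_finite_net:
  assumes "totally_bounded_in m S" and "0 < e"
  obtains K where "finite K" "K \<subseteq> mspace m" "\<And>x. x \<in> S \<Longrightarrow> \<exists>y\<in>K. mdist m x y \<le> e"
proof -
  obtain \<C> where C: "finite \<C>" "\<And>A. A \<in> \<C> \<Longrightarrow> A \<subseteq> mspace m \<and> mdiameter m A \<le> ennreal e" "S \<subseteq> \<Union>\<C>"
    using assms unfolding totally_bounded_in_def by meson
  define c where "c A = (SOME y. y \<in> A)" for A :: "'a set"
  have c: "c A \<in> A" if "x \<in> A" for x A
    unfolding c_def using that by (rule someI)
  show thesis
  proof
    \<comment> \<open>The empty set is removed because \<open>c {}\<close> is an arbitrary value
      that may lie outside the space.\<close>
    show "finite (c ` (\<C> - {{}}))"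
      using C(1) by simp
    show "c ` (\<C> - {{}}) \<subseteq> mspace m"
      using C(2) c by blast
    fix x
    assume "x \<in> S"
    then obtain A where A: "A \<in> \<C>" "x \<in> A"
      using C(3) by blast
    then have "mdist m x (c A) \<le> e"
      using C(2)[OF A(1)] c[OF A(2)] \<open>0 < e\<close> by (simp add: mdiameter_le_iff)
    then show "\<exists>y\<in>c ` (\<C> - {{}}). mdist m x y \<le> e"
      using A by blast
  qed
qed

lemma abs_diff_le_mdist_cfunspace:
  fixes f g :: "'a \<Rightarrow> real"
  assumes "f \<in> mspace (cfunspace X euclidean_metric)" "g \<in> mspace (cfunspace X euclidean_metric)"
    and "mdist (cfunspace X euclidean_metric) f g \<le> e" and "x \<in> topspace X"
  shows "\<bar>f x - g x\<bar> \<le> e"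
  using mdist_cfunspace_imp_mdist_le[OF assms] by (simp add: dist_real_def)

lemma totally_bounded_in_cfunspace_imp_pointwise_bounded:
  assumes tb: "totally_bounded_in (cfunspace X euclidean_metric) F"
  shows "pointwise_bounded X F"
  unfolding pointwise_bounded_def
proof
  fix x
  assume x: "x \<in> topspace X"
  have F: "F \<subseteq> mspace (cfunspace X euclidean_metric)"
    using tb by (simp add: totally_bounded_in_def)
  obtain K where K: "finite K" "K \<subseteq> mspace (cfunspace X euclidean_metric)"
      "\<And>f. f \<in> F \<Longrightarrow> \<exists>g\<in>K. mdist (cfunspace X euclidean_metric) f g \<le> 1"
    using totally_bounded_in_imp_finite_net[OF tb zero_less_one] by metis
  show "bdd_above ((\<lambda>f. \<bar>f x\<bar>) ` F)"
  proof (rule bdd_aboveI2)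
    fix f
    assume "f \<in> F"
    then obtain g where g: "g \<in> K" "mdist (cfunspace X euclidean_metric) f g \<le> 1"
      using K(3) by blast
    have "\<bar>f x - g x\<bar> \<le> 1"
      using subsetD[OF F \<open>f \<in> F\<close>] subsetD[OF K(2) g(1)] g(2) x by (rule abs_diff_le_mdist_cfunspace)
    \<comment> \<open>The sum dominates each of its nonnegative terms and replaces a maximum over
      \<open>K\<close>, which could be empty.\<close>
    moreover have "\<bar>g x\<bar> \<le> (\<Sum>g\<in>K. \<bar>g x\<bar>)"
      using g(1) K(1) by (intro member_le_sum) auto
    ultimately show "\<bar>f x\<bar> \<le> (\<Sum>g\<in>K. \<bar>g x\<bar>) + 1"
      by linarith
  qed
qed

lemma totally_bounded_in_cfunspace_imp_equicontinuous:
  assumes tb: "totally_bounded_in (cfunspace X euclidean_metric) F"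
  shows "equicontinuous X F"
  unfolding equicontinuous_def
proof (intro ballI allI impI)
  fix x and e :: real
  assume x: "x \<in> topspace X" and "0 < e"
  have F: "F \<subseteq> mspace (cfunspace X euclidean_metric)"
    using tb by (simp add: totally_bounded_in_def)
  obtain K where K: "finite K" "K \<subseteq> mspace (cfunspace X euclidean_metric)"
      "\<And>f. f \<in> F \<Longrightarrow> \<exists>g\<in>K. mdist (cfunspace X euclidean_metric) f g \<le> e/3"
    using totally_bounded_in_imp_finite_net[OF tb, of "e/3"] \<open>0 < e\<close>
    by (metis zero_less_divide_iff zero_less_numeral)
  \<comment> \<open>The difference \<open>f y - f x\<close> is split through \<open>g y\<close> and
    \<open>g x\<close> into three parts of size \<open>e/3\<close>; the middle one is kept strict,
    so the total stays below \<open>e\<close>.\<close>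
  define U where "U g = {y \<in> topspace X. g y \<in> ball (g x) (e/3)}" for g :: "'a \<Rightarrow> real"
  \<comment> \<open>An intersection over empty \<open>K\<close> is \<open>UNIV\<close>, so
    intersecting with \<open>topspace X\<close> keeps \<open>V\<close> inside the space.\<close>
  define V where "V = topspace X \<inter> (\<Inter>g\<in>K. U g)"
  have "openin X (U g)" if "g \<in> K" for g
  proof -
    have "continuous_map X euclideanreal g"
      using that K(2) by auto
    then show ?thesis
      unfolding U_def by (rule openin_continuous_map_preimage) simp
  qed
  then have "openin X V"
    using K(1) unfolding V_def by (cases "K = {}") (auto intro!: openin_Inter)
  moreover have "x \<in> V"
    using x \<open>0 < e\<close> by (simp add: V_def U_def)
  ultimately have "neighbourhood_in X x V"
    unfolding neighbourhood_in_def using openin_subset by blast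
  moreover have "\<bar>f y - f x\<bar> < e" if "y \<in> V" "f \<in> F" for y f
  proof -
    have y: "y \<in> topspace X"
      using \<open>y \<in> V\<close> by (simp add: V_def)
    obtain g where g: "g \<in> K" "mdist (cfunspace X euclidean_metric) f g \<le> e/3"
      using K(3) \<open>f \<in> F\<close> by blast
    have "\<bar>f z - g z\<bar> \<le> e/3" if "z \<in> topspace X" for z
      using subsetD[OF F \<open>f \<in> F\<close>] subsetD[OF K(2) g(1)] g(2) that
      by (rule abs_diff_le_mdist_cfunspace)
    from this[OF x] this[OF y] have "\<bar>f x - g x\<bar> \<le> e/3" "\<bar>f y - g y\<bar> \<le> e/3" .
    moreover have "\<bar>g x - g y\<bar> < e/3"
      using \<open>y \<in> V\<close> g(1) by (simp add: V_def U_def dist_real_def)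
    ultimately show ?thesis
      by linarith
  qed
  ultimately show "\<exists>V. neighbourhood_in X x V \<and> (\<forall>y\<in>V. \<forall>f\<in>F. \<bar>f y - f x\<bar> < e)"
    by blast
qed

text \<open>\<open>T\<close> collects the centres of a finite subcover of the sets given by
  equicontinuity. Each such set serves all of \<open>F\<close> at once, so \<open>x\<close> depends
  on \<open>y\<close> but not on \<open>f\<close>.\<close>

lemma equicontinuous_compact_finite_net:
  assumes "compact_space X" "equicontinuous X F" "0 < e"
  obtains T where "finite T" "T \<subseteq> topspace X"
    "\<And>y. y \<in> topspace X \<Longrightarrow> \<exists>x\<in>T. \<forall>f\<in>F. \<bar>f y - f x\<bar> < e"
proof -
  \<comment> \<open>Neighbourhoods are shrunk to open sets so that compactness applies.\<close>
  have "\<exists>U. openin X U \<and> x \<in> U \<and> (\<forall>y\<in>U. \<forall>f\<in>F. \<bar>f y - f x\<bar> < e)" if x: "x \<in> topspace X" for x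
    using assms(2) x \<open>0 < e\<close> unfolding equicontinuous_def neighbourhood_in_def by (meson subsetD)
  then obtain U where U: "\<And>x. x \<in> topspace X \<Longrightarrow> openin X (U x)" "\<And>x. x \<in> topspace X \<Longrightarrow> x \<in> U x"
      "\<And>x y f. \<lbrakk>x \<in> topspace X; y \<in> U x; f \<in> F\<rbrakk> \<Longrightarrow> \<bar>f y - f x\<bar> < e"
    by metis
  have "\<exists>\<F>. finite \<F> \<and> \<F> \<subseteq> U ` topspace X \<and> topspace X \<subseteq> \<Union>\<F>"
    using assms(1) U(1,2) unfolding compact_space_def by (intro compactinD) auto
  then obtain T where "finite T" "T \<subseteq> topspace X" "topspace X \<subseteq> \<Union>(U ` T)"
    by (metis finite_subset_image)
  with U(3) show thesis
    by (intro that[of T]) blast+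
qed

text \<open>At each point of \<open>T\<close> the rounded values fill a bounded integer interval,
  and a finite product of finite sets is finite. \<open>restrict\<close> fixes the signature off
  \<open>T\<close>, without which it would not lie in that product.\<close>

lemma pointwise_bounded_finite_signatures:
  assumes "pointwise_bounded X F" "finite T" "T \<subseteq> topspace X" "0 < d"
  shows "finite ((\<lambda>f. restrict (\<lambda>x. \<lfloor>f x / d\<rfloor>) T) ` F)"
proof -
  obtain B where B: "\<And>x f. \<lbrakk>x \<in> T; f \<in> F\<rbrakk> \<Longrightarrow> \<bar>f x\<bar> \<le> B x"
    using assms(1,3) unfolding pointwise_bounded_def bdd_above_def by (simp add: subset_iff) metis
  have "\<lfloor>f x / d\<rfloor> \<in> {\<lfloor>- B x / d\<rfloor>..\<lfloor>B x / d\<rfloor>}" if "x \<in> T" "f \<in> F" for x f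
  proof -
    have "- B x \<le> f x" "f x \<le> B x"
      using B[OF that] by linarith+
    then show ?thesis
      using \<open>0 < d\<close> unfolding atLeastAtMost_iff by (intro conjI floor_mono divide_right_mono) auto
  qed
  then have "(\<lambda>f. restrict (\<lambda>x. \<lfloor>f x / d\<rfloor>) T) ` F \<subseteq> (\<Pi>\<^sub>E x\<in>T. {\<lfloor>- B x / d\<rfloor>..\<lfloor>B x / d\<rfloor>})"
    by (auto simp: PiE_iff)
  then show ?thesis
    by (rule finite_subset) (simp add: finite_PiE \<open>finite T\<close>)
qed

text \<open>Equal floors put both quotients into one half-open interval of length 1.\<close>

lemma abs_diff_less_if_floor_divide_eq:
  fixes a b d :: real
  assumes "\<lfloor>a / d\<rfloor> = \<lfloor>b / d\<rfloor>" "0 < d"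
  shows "\<bar>a - b\<bar> < d"
proof -
  have "\<bar>a / d - b / d\<bar> < 1"
    using assms(1) by linarith
  then show ?thesis
    using \<open>0 < d\<close> by (simp add: diff_divide_distrib[symmetric])
qed

lemma totally_bounded_in_cfunspace_if_equicontinuous:
  assumes "compact_space X" and F: "F \<subseteq> mspace (cfunspace X euclidean_metric)"
    and "pointwise_bounded X F" "equicontinuous X F"
  shows "totally_bounded_in (cfunspace X euclidean_metric) F"
  unfolding totally_bounded_in_def
proof (intro conjI allI impI)
  show "F \<subseteq> mspace (cfunspace X euclidean_metric)"
    by (rule F)
  fix e :: real
  assume "0 < e"
  then have d: "0 < e/3"
    by simp
  obtain T where T: "finite T" "T \<subseteq> topspace X"
      "\<And>y. y \<in> topspace X \<Longrightarrow> \<exists>x\<in>T. \<forall>f\<in>F. \<bar>f y - f x\<bar> < e/3"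
    using equicontinuous_compact_finite_net[OF assms(1,4) d] by metis
  \<comment> \<open>Mesh \<open>e/3\<close> matches the net: \<open>f y - g y\<close> passes through
    \<open>f x\<close> and \<open>g x\<close>, with each of the three differences below
    \<open>e/3\<close>.\<close>
  define s where "s f = restrict (\<lambda>x. \<lfloor>f x / (e/3)\<rfloor>) T" for f :: "'a \<Rightarrow> real"
  \<comment> \<open>The cover consists of the fibres of \<open>s\<close> on \<open>F\<close>, one
    for each signature that occurs.\<close>
  define \<C> where "\<C> = (\<lambda>k. {f \<in> F. s f = k}) ` (s ` F)"
  have "finite \<C>"
    using pointwise_bounded_finite_signatures[OF assms(3) T(1,2) d]
    unfolding \<C>_def s_def by blast
  moreover have "mdist (cfunspace X euclidean_metric) f g \<le> e"
    if "f \<in> F" "g \<in> F" "s f = s g" for f g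
  proof (rule mdist_cfunspace_le)
    fix y
    assume "y \<in> topspace X"
    then obtain x where x: "x \<in> T" "\<And>h. h \<in> F \<Longrightarrow> \<bar>h y - h x\<bar> < e/3"
      using T(3) by blast
    have "\<lfloor>f x / (e/3)\<rfloor> = \<lfloor>g x / (e/3)\<rfloor>"
      using fun_cong[OF \<open>s f = s g\<close>, of x] x(1) unfolding s_def by (simp only: restrict_apply if_True)
    then have "\<bar>f x - g x\<bar> < e/3"
      using d by (rule abs_diff_less_if_floor_divide_eq)
    moreover have "\<bar>f y - f x\<bar> < e/3" "\<bar>g y - g x\<bar> < e/3"
      using x(2) that by blast+
    ultimately show "mdist euclidean_metric (f y) (g y) \<le> e"
      unfolding mdist_euclidean_metric dist_real_def by linarith
  qed (use \<open>0 < e\<close> in simp)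
  then have "\<forall>A\<in>\<C>. A \<subseteq> mspace (cfunspace X euclidean_metric) \<and>
      mdiameter (cfunspace X euclidean_metric) A \<le> ennreal e"
    using F \<open>0 < e\<close> unfolding \<C>_def by (auto simp: mdiameter_le_iff simp del: mspace_cfunspace)
  moreover have "F \<subseteq> \<Union>\<C>"
    unfolding \<C>_def by blast
  ultimately show "\<exists>\<C>. finite \<C> \<and> (\<forall>A\<in>\<C>. A \<subseteq> mspace (cfunspace X euclidean_metric) \<and>
      mdiameter (cfunspace X euclidean_metric) A \<le> ennreal e) \<and> F \<subseteq> \<Union>\<C>"
    by blast
qed

theorem theorem2:
  fixes \<Omega> :: "'a topology" and F :: "('a \<Rightarrow> real) set"
  assumes "compact_space \<Omega>"
    and "F \<subseteq> mspace (cfunspace \<Omega> euclidean_metric)"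
  shows "totally_bounded_in (cfunspace \<Omega> euclidean_metric) F \<longleftrightarrow>
           pointwise_bounded \<Omega> F \<and> equicontinuous \<Omega> F"
  using totally_bounded_in_cfunspace_imp_pointwise_bounded
    totally_bounded_in_cfunspace_imp_equicontinuous
    totally_bounded_in_cfunspace_if_equicontinuous[OF assms]
  by blast

end
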